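(* Let $t\ge 3$ and $n\ge 1$ be integers. Then $$M(t,n)=U(t,n):=\sum_{j=0}^{t}\binom{t}{j}\binom{n}{j}\,j!,$$ and, up to renaming elements, $F^*=(A_1^*,\dots,A_n^* )$ with $A_i^*=\{i,n+1,\dots,n+t\}$ for $1\le i\le n$ is the only $(t,n)$-family $F$ with $N(F)=M(t,n)$. That is, a $(t,n)$-family $F=(A_1,\dots,A_n)$ satisfies $N(F)=M(t,n)$ if and only if there is a bijection $\varphi:\bigcup_{i=1}^n A_i\to\{1,\dots,n+t\}$ with $\varphi(A_i)=A_i^*$ for all $1\le i\le n$.
   Context: A system of distinct representatives (SDR) of a family of finite sets $F=(A_1,\dots,A_n)$ is a sequence $(x_1,\dots,x_n)$ of $n$ pairwise distinct elements with $x_i\in A_i$ for $1\le i\le n$. $N(F)$ denotes the number of SDRs of $F$; two SDRs are distinct if they differ in at least one component. For a nonnegative integer $t$, a family $F=(A_1,\dots,A_n)$ of finite sets is a $(t,n)$-family if $\left|\bigcup_{i\in I}A_i\right|\ge |I|+t$ for every non-empty $I\subseteq\{1,\dots,n\}$. $M(t,n)$ is the minimum of $N(F)$ over all $(t,n)$-families $F$. The convention $\binom{n}{j}=0$ for $j>n$ is used. *)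

theory Defs
  imports Complex_Main "HOL-Library.FuncSet"
begin

text \<open>
  A family \<open>(A\<^sub>1, \<dots>, A\<^sub>n)\<close> is a function \<open>A :: nat \<Rightarrow> 'a set\<close> of which only the values on
  \<open>{1..n}\<close> matter. A sequence \<open>(x\<^sub>1, \<dots>, x\<^sub>n)\<close> is a function in \<open>PiE {1..n} A\<close>, which is
  \<open>undefined\<close> outside \<open>{1..n}\<close>, so that sequences are counted by their \<open>n\<close> components.
\<close>

definition SDRs :: "nat \<Rightarrow> (nat \<Rightarrow> 'a set) \<Rightarrow> (nat \<Rightarrow> 'a) set" where
  "SDRs n A = {x \<in> PiE {1..n} A. inj_on x {1..n}}"

definition num_SDRs :: "nat \<Rightarrow> (nat \<Rightarrow> 'a set) \<Rightarrow> nat" where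
  "num_SDRs n A = card (SDRs n A)"

definition tn_family :: "nat \<Rightarrow> nat \<Rightarrow> (nat \<Rightarrow> 'a set) \<Rightarrow> bool" where
  "tn_family t n A \<longleftrightarrow>
     (\<forall>i\<in>{1..n}. finite (A i)) \<and>
     (\<forall>I. I \<subseteq> {1..n} \<and> I \<noteq> {} \<longrightarrow> card (\<Union>i\<in>I. A i) \<ge> card I + t)"

text \<open>
  The minimum ranges over families of finite sets of natural numbers. This loses nothing: every
  finite family can be renamed injectively into \<open>nat\<close> without changing its number of SDRs
  (see \<open>min_SDRs_le\<close> below for families over an arbitrary type).
\<close>

definition min_SDRs :: "nat \<Rightarrow> nat \<Rightarrow> nat" where
  "min_SDRs t n = (LEAST k. \<exists>A :: nat \<Rightarrow> nat set. tn_family t n A \<and> num_SDRs n A = k)"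

definition U :: "nat \<Rightarrow> nat \<Rightarrow> nat" where
  "U t n = (\<Sum>j = 0..t. (t choose j) * (n choose j) * fact j)"

definition Fstar :: "nat \<Rightarrow> nat \<Rightarrow> nat \<Rightarrow> nat set" where
  "Fstar t n i = insert i {n + 1..n + t}"

lemma tn_family_rename:
  assumes "inj_on f (\<Union>i\<in>{1..n}. A i)" and "tn_family t n A"
  shows "tn_family t n (\<lambda>i. f ` A i)"
  unfolding tn_family_def
proof (intro conjI ballI allI impI)
  fix i assume "i \<in> {1..n}"
  then show "finite (f ` A i)"
    using assms(2) by (auto simp: tn_family_def)
next
  fix I assume I: "I \<subseteq> {1..n} \<and> I \<noteq> {}"
  then have "inj_on f (\<Union>i\<in>I. A i)"
    by (intro inj_on_subset[OF assms(1)]) blast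
  then have "card (\<Union>i\<in>I. f ` A i) = card (\<Union>i\<in>I. A i)"
    by (simp flip: image_UN add: card_image)
  then show "card (\<Union>i\<in>I. f ` A i) \<ge> card I + t"
    using I assms(2) by (simp add: tn_family_def)
qed

lemma num_SDRs_rename:
  assumes inj: "inj_on f (\<Union>i\<in>{1..n}. A i)"
  shows "num_SDRs n (\<lambda>i. f ` A i) = num_SDRs n A"
proof -
  let ?V = "\<Union>i\<in>{1..n}. A i"
  let ?g = "inv_into ?V f"
  have gf: "?g (f a) = a" if "a \<in> A i" "i \<in> {1..n}" for a i
    using that by (intro inv_into_f_f[OF inj]) blast
  have "bij_betw (\<lambda>x. restrict (f \<circ> x) {1..n}) (SDRs n A) (SDRs n (\<lambda>i. f ` A i))"
  proof (rule bij_betw_byWitness[where f' = "\<lambda>y. restrict (?g \<circ> y) {1..n}"])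
    show "\<forall>x\<in>SDRs n A. restrict (?g \<circ> restrict (f \<circ> x) {1..n}) {1..n} = x"
    proof
      fix x assume "x \<in> SDRs n A"
      then have x: "x \<in> PiE {1..n} A" by (simp add: SDRs_def)
      show "restrict (?g \<circ> restrict (f \<circ> x) {1..n}) {1..n} = x"
      proof
        fix i show "restrict (?g \<circ> restrict (f \<circ> x) {1..n}) {1..n} i = x i"
          using PiE_mem[OF x, of i] PiE_arb[OF x, of i] gf[of "x i" i]
          by (cases "i \<in> {1..n}") auto
      qed
    qed
    show "\<forall>y\<in>SDRs n (\<lambda>i. f ` A i). restrict (f \<circ> restrict (?g \<circ> y) {1..n}) {1..n} = y"
    proof
      fix y assume "y \<in> SDRs n (\<lambda>i. f ` A i)"
      then have y: "y \<in> PiE {1..n} (\<lambda>i. f ` A i)" by (simp add: SDRs_def)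
      show "restrict (f \<circ> restrict (?g \<circ> y) {1..n}) {1..n} = y"
      proof
        fix i
        have "f (?g (y i)) = y i" if "i \<in> {1..n}"
          using PiE_mem[OF y that] that by (intro f_inv_into_f) blast
        then show "restrict (f \<circ> restrict (?g \<circ> y) {1..n}) {1..n} i = y i"
          using PiE_arb[OF y, of i] by (cases "i \<in> {1..n}") auto
      qed
    qed
    show "(\<lambda>x. restrict (f \<circ> x) {1..n}) ` SDRs n A \<subseteq> SDRs n (\<lambda>i. f ` A i)"
    proof (intro image_subsetI)
      fix x assume "x \<in> SDRs n A"
      then have x: "x \<in> PiE {1..n} A" and xi: "inj_on x {1..n}" by (simp_all add: SDRs_def)
      have "inj_on f (x ` {1..n})"
        using x by (intro inj_on_subset[OF inj]) (auto dest: PiE_mem)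
      then have "inj_on (f \<circ> x) {1..n}"
        using xi by (rule comp_inj_on[rotated])
      then show "restrict (f \<circ> x) {1..n} \<in> SDRs n (\<lambda>i. f ` A i)"
        unfolding SDRs_def using PiE_mem[OF x]
        by (simp add: restrict_PiE_iff)
    qed
    show "(\<lambda>y. restrict (?g \<circ> y) {1..n}) ` SDRs n (\<lambda>i. f ` A i) \<subseteq> SDRs n A"
    proof (intro image_subsetI)
      fix y assume "y \<in> SDRs n (\<lambda>i. f ` A i)"
      then have y: "y \<in> PiE {1..n} (\<lambda>i. f ` A i)" and yi: "inj_on y {1..n}"
        by (simp_all add: SDRs_def)
      have mem: "?g (y i) \<in> A i" if "i \<in> {1..n}" for i
        using PiE_mem[OF y that] gf[OF _ that] by auto
      have "inj_on ?g (y ` {1..n})"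
        using PiE_mem[OF y] by (intro inj_on_inv_into) blast
      then have "inj_on (?g \<circ> y) {1..n}"
        using yi by (rule comp_inj_on[rotated])
      then show "restrict (?g \<circ> y) {1..n} \<in> SDRs n A"
        unfolding SDRs_def using mem
        by (simp add: restrict_PiE_iff)
    qed
  qed
  then show ?thesis
    unfolding num_SDRs_def by (metis bij_betw_same_card)
qed

lemma min_SDRs_le:
  fixes A :: "nat \<Rightarrow> 'a set"
  assumes "tn_family t n A"
  shows "min_SDRs t n \<le> num_SDRs n A"
proof -
  have "finite (\<Union>i\<in>{1..n}. A i)"
    using assms by (auto simp: tn_family_def)
  from finite_imp_inj_to_nat_seg[OF this]
  obtain f :: "'a \<Rightarrow> nat" where f: "inj_on f (\<Union>i\<in>{1..n}. A i)" by auto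
  show ?thesis
    unfolding min_SDRs_def
    by (rule Least_le) (intro exI conjI, rule tn_family_rename[OF f assms], rule num_SDRs_rename[OF f])
qed

lemma tn_family_Fstar: "tn_family t n (Fstar t n)"
  unfolding tn_family_def
proof (intro conjI ballI allI impI)
  fix I assume I: "I \<subseteq> {1..n} \<and> I \<noteq> {}"
  then have fin: "finite I" by (meson finite_atLeastAtMost finite_subset)
  have "(\<Union>i\<in>I. Fstar t n i) = I \<union> {n + 1..n + t}"
    using I by (auto simp: Fstar_def)
  moreover have "I \<inter> {n + 1..n + t} = {}"
    using I by (force simp: disjoint_iff)
  ultimately show "card (\<Union>i\<in>I. Fstar t n i) \<ge> card I + t"
    using fin by (simp add: card_Un_disjoint)
qed (simp add: Fstar_def)

lemma min_SDRs_attained: "\<exists>A :: nat \<Rightarrow> nat set. tn_family t n A \<and> num_SDRs n A = min_SDRs t n"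
proof -
  have "\<exists>k. \<exists>A :: nat \<Rightarrow> nat set. tn_family t n A \<and> num_SDRs n A = k"
    by (intro exI conjI) (rule tn_family_Fstar, rule refl)
  then show ?thesis
    unfolding min_SDRs_def by (rule LeastI_ex)
qed

end

(*
  A family that is not of the form F* is replaced by one with strictly fewer SDRs.
  If some |A_i| >= t+2, then by submodularity of I |-> |UN I| - |I| one of any two elements of
  A_i can be deleted. If every |A_i| = t+1 but the sets share fewer than t elements, then y is
  replaced by x in all sets containing y but not x. If each of x and y lies in some A_i
  without the other, this strictly lowers the number of SDRs. It can violate the
  union condition only at a tight index set I (one with |UN I| = |I| + t) whose union contains x
  and y while no A_i with i in I contains both. For fixed x at most |{i. x \<notin> A_i}| elements y
  are obstructed in this way, while the sets avoiding x cover at least t more elements than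
  that, so a suitable y exists outside the common core; choosing x of maximal degree outside the
  core makes x and y incomparable.
*)
theory Submission
  imports Defs
begin

section \<open>The union condition with surplus \<open>t\<close>, deletion of elements, Hall's
  theorem\<close>

definition hall_family :: "nat \<Rightarrow> 'i set \<Rightarrow> ('i \<Rightarrow> 'a set) \<Rightarrow> bool" where
  "hall_family t J A \<longleftrightarrow> (\<forall>i\<in>J. finite (A i)) \<and>
     (\<forall>I\<subseteq>J. I \<noteq> {} \<longrightarrow> card I + t \<le> card (\<Union>(A ` I)))"

lemma tn_family_iff_hall_family: "tn_family t n A \<longleftrightarrow> hall_family t {1..n} A"
  unfolding tn_family_def hall_family_def by blast

lemma hall_familyD:
  "hall_family t J A \<Longrightarrow> I \<subseteq> J \<Longrightarrow> I \<noteq> {} \<Longrightarrow> card I + t \<le> card (\<Union>(A ` I))"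
  unfolding hall_family_def by blast

lemma hall_family_finite_UN:
  "hall_family t J A \<Longrightarrow> finite J \<Longrightarrow> I \<subseteq> J \<Longrightarrow> finite (\<Union>(A ` I))"
  unfolding hall_family_def by (meson finite_UN_I finite_subset subsetD)

lemma hall_family_card_mem:
  assumes "hall_family t J A" "i \<in> J"
  shows "t + 1 \<le> card (A i)"
  using hall_familyD[OF assms(1), of "{i}"] assms(2) by simp

lemma hall_family_Diff_weaken:
  assumes H: "hall_family (s + card S) J A" and "finite S"
  shows "hall_family s J (\<lambda>i. A i - S)"
  unfolding hall_family_def
proof (intro conjI ballI allI impI)
  fix i assume "i \<in> J" then show "finite (A i - S)"
    using H by (simp add: hall_family_def)
next
  fix I assume I: "I \<subseteq> J" "I \<noteq> {}"
  have "(\<Union>i\<in>I. A i - S) = \<Union>(A ` I) - S" by blast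
  moreover have "card (\<Union>(A ` I)) - card S \<le> card (\<Union>(A ` I) - S)"
    using \<open>finite S\<close> by (rule diff_card_le_card_Diff)
  ultimately show "card I + s \<le> card (\<Union>i\<in>I. A i - S)"
    using hall_familyD[OF H I] by simp
qed

lemma hall_family_subset: "hall_family t J A \<Longrightarrow> K \<subseteq> J \<Longrightarrow> hall_family t K A"
  unfolding hall_family_def by (meson subset_iff)

lemma hall_family_mono: "hall_family t J A \<Longrightarrow> s \<le> t \<Longrightarrow> hall_family s J A"
  unfolding hall_family_def by (meson add_left_mono order_trans)

text \<open>Unions over index sets without \<open>i\<close> are unchanged, so a violating set
  contains \<open>i\<close>. The witness \<open>I\<close> leaves \<open>i\<close> out, which turns
  the strict deficit into \<le>; it may be empty.\<close>

lemma hall_family_remove_violator: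
  assumes H: "hall_family t J A" and "finite J" "i \<in> J"
    and neg: "\<not> hall_family t J (A(i := A i - {y}))"
  obtains I where "I \<subseteq> J - {i}" "card (\<Union>(A ` I) \<union> (A i - {y})) \<le> card I + t"
proof -
  let ?B = "A(i := A i - {y})"
  have "\<forall>j\<in>J. finite (?B j)" using H by (simp add: hall_family_def)
  with neg obtain I where I: "I \<subseteq> J" "I \<noteq> {}" and less: "card (\<Union>(?B ` I)) < card I + t"
    unfolding hall_family_def by (meson not_le)
  have iI: "i \<in> I"
  proof (rule ccontr)
    assume "i \<notin> I"
    then have "\<Union>(?B ` I) = \<Union>(A ` I)" by auto
    then show False using less hall_familyD[OF H I] by simp
  qed
  have "\<Union>(?B ` I) = \<Union>(A ` (I - {i})) \<union> (A i - {y})"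
    using iI by (auto split: if_splits)
  moreover have "card I = Suc (card (I - {i}))"
    using iI finite_subset[OF I(1) \<open>finite J\<close>] by (simp only: card_Suc_Diff1)
  ultimately show thesis
    using less I by (intro that[of "I - {i}"]) auto
qed

text \<open>Submodularity: the truncated unions \<open>?P\<close> and \<open>?Q\<close> of violators
  for \<open>y\<close> and \<open>z\<close> have sizes adding up to at most
  \<open>card I + card K + 2 * t\<close>, whereas the union condition forces at least one more on
  their union and intersection together.\<close>

lemma hall_family_remove:
  assumes H: "hall_family t J A" and "finite J" "i \<in> J"
    and yz: "y \<in> A i" "z \<in> A i" "y \<noteq> z" and big: "t + 2 \<le> card (A i)"
  shows "hall_family t J (A(i := A i - {y})) \<or> hall_family t J (A(i := A i - {z}))"
proof (rule ccontr)
  assume "\<not> ?thesis"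
  then obtain I K where I: "I \<subseteq> J - {i}" "card (\<Union>(A ` I) \<union> (A i - {y})) \<le> card I + t"
    and K: "K \<subseteq> J - {i}" "card (\<Union>(A ` K) \<union> (A i - {z})) \<le> card K + t"
    using hall_family_remove_violator[OF H \<open>finite J\<close> \<open>i \<in> J\<close>] by metis
  let ?P = "\<Union>(A ` I) \<union> (A i - {y})" and ?Q = "\<Union>(A ` K) \<union> (A i - {z})"
  have fA: "finite (A i)" using H \<open>i \<in> J\<close> by (simp add: hall_family_def)
  have fin: "finite ?P" "finite ?Q"
    using hall_family_finite_UN[OF H \<open>finite J\<close>] I K fA by blast+
  have finIK: "finite I" "finite K"
    using I(1) K(1) \<open>finite J\<close> by (meson finite_Diff finite_subset)+
  have un: "?P \<union> ?Q = \<Union>(A ` insert i (I \<union> K))" using yz by auto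
  have "card (insert i (I \<union> K)) + t \<le> card (?P \<union> ?Q)"
    unfolding un using I K \<open>i \<in> J\<close> by (intro hall_familyD[OF H]) auto
  moreover have "card (insert i (I \<union> K)) = Suc (card (I \<union> K))"
    using I K finIK by (subst card_insert_disjoint) auto
  moreover have "card (I \<inter> K) + t \<le> card (?P \<inter> ?Q)"
  proof (cases "I \<inter> K = {}")
    \<comment> \<open>The union condition says nothing about the empty index set; here
      \<open>A i\<close> without \<open>y\<close> and \<open>z\<close> still supplies
      \<open>t\<close> elements, by \<open>big\<close>.\<close>
    case True
    have "card (A i - {y, z}) \<le> card (?P \<inter> ?Q)"
      using fin by (intro card_mono) auto
    moreover have "card (A i - {y, z}) = card (A i) - 2"
      using yz by (subst card_Diff_subset) auto
    ultimately show ?thesis using big True by simp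
  next
    case False
    have "card (I \<inter> K) + t \<le> card (\<Union>(A ` (I \<inter> K)))"
      using I False by (intro hall_familyD[OF H]) auto
    also have "\<dots> \<le> card (?P \<inter> ?Q)" using fin by (intro card_mono) auto
    finally show ?thesis .
  qed
  ultimately show False
    using card_Un_Int[OF fin] card_Un_Int[OF finIK] I(2) K(2) by linarith
qed

text \<open>Rado's argument: sets with two elements are thinned by \<open>hall_family_remove\<close>
  with \<open>t = 0\<close> until all are singletons; the condition on pairs then makes the choice
  injective.\<close>

lemma hall_marriage:
  fixes A :: "'i \<Rightarrow> 'a set"
  assumes "hall_family 0 J A" and fJ: "finite J"
  shows "\<exists>f \<in> PiE J A. inj_on f J"
  using assms(1)
proof (induction "\<Sum>i\<in>J. card (A i)" arbitrary: A rule: less_induct)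
  case less
  note H = less.prems
  show ?case
  proof (cases "\<exists>i\<in>J. 2 \<le> card (A i)")
    case True
    then obtain i where i: "i \<in> J" "2 \<le> card (A i)" by blast
    then obtain y z where yz: "y \<in> A i" "z \<in> A i" "y \<noteq> z"
      by (metis card_le_Suc0_iff_eq card.infinite not_less_eq_eq numeral_2_eq_2 zero_le)
    obtain w where w: "w \<in> A i" "hall_family 0 J (A(i := A i - {w}))"
      using hall_family_remove[OF H fJ i(1) yz] i yz by auto
    have fA: "finite (A i)" using H i by (simp add: hall_family_def)
    have "(\<Sum>j\<in>J. card ((A(i := A i - {w})) j)) < (\<Sum>j\<in>J. card (A j))"
      using i fJ w(1) fA
      by (intro sum_strict_mono_ex1 ballI bexI[of _ i])
         (auto intro: card_Diff1_le card_Diff1_less)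
    from less.hyps[OF this w(2)]
    obtain f where f: "f \<in> PiE J (A(i := A i - {w}))" "inj_on f J" by blast
    then have "f \<in> PiE J A" by (auto simp: PiE_iff split: if_splits)
    then show ?thesis using f(2) by blast
  next
    case False
    have "\<exists>a. A i = {a}" if "i \<in> J" for i
      using hall_family_card_mem[OF H that] False that
      by (metis Suc_1 One_nat_def add_0 card_1_singletonE le_antisym not_less_eq_eq)
    then obtain a where a: "\<And>i. i \<in> J \<Longrightarrow> A i = {a i}" by metis
    have "inj_on a J"
    proof (rule inj_onI, rule ccontr)
      fix i j assume "i \<in> J" "j \<in> J" "a i = a j" "i \<noteq> j"
      then show False using hall_familyD[OF H, of "{i, j}"] a by simp
    qed
    then have "inj_on (restrict a J) J" by (simp add: inj_on_def)
    moreover have "restrict a J \<in> PiE J A" using a by auto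
    ultimately show ?thesis by blast
  qed
qed

section \<open>Tight index sets and the elements they obstruct\<close>

definition tight :: "nat \<Rightarrow> ('i \<Rightarrow> 'a set) \<Rightarrow> 'i set \<Rightarrow> bool" where
  "tight t A I \<longleftrightarrow> card (\<Union>(A ` I)) = card I + t"

text \<open>The surplus of the union over the number of indices is submodular and at least
  \<open>t\<close> on non-empty sets. Tight sets are its minimisers, so equality holds throughout,
  also in the trivial inclusion behind the third claim.\<close>

lemma tight_Un_Int:
  assumes H: "hall_family t J A" and "finite J" and IK: "I \<subseteq> J" "K \<subseteq> J" "I \<inter> K \<noteq> {}"
    and tight: "tight t A I" "tight t A K"
  shows "tight t A (I \<union> K)" "tight t A (I \<inter> K)"
    "\<Union>(A ` (I \<inter> K)) = \<Union>(A ` I) \<inter> \<Union>(A ` K)"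
proof -
  let ?V = "\<lambda>I. \<Union>(A ` I)"
  have fin: "finite (?V I)" "finite (?V K)"
    using hall_family_finite_UN[OF H \<open>finite J\<close>] IK by blast+
  have finIK: "finite I" "finite K"
    using IK \<open>finite J\<close> by (meson finite_subset)+
  have Vun: "?V (I \<union> K) = ?V I \<union> ?V K" by blast
  have "card (I \<union> K) + t \<le> card (?V I \<union> ?V K)"
    unfolding Vun[symmetric] using IK by (intro hall_familyD[OF H]) auto
  moreover have int: "card (I \<inter> K) + t \<le> card (?V (I \<inter> K))"
    using IK by (intro hall_familyD[OF H]) auto
  moreover have sub: "?V (I \<inter> K) \<subseteq> ?V I \<inter> ?V K" by blast
  moreover have "card (?V (I \<inter> K)) \<le> card (?V I \<inter> ?V K)"
    using sub fin by (intro card_mono) auto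
  moreover note card_Un_Int[OF fin] card_Un_Int[OF finIK] tight[unfolded tight_def]
  ultimately have *: "card (?V I \<union> ?V K) = card (I \<union> K) + t \<and>
    card (?V (I \<inter> K)) = card (I \<inter> K) + t \<and>
    card (?V I \<inter> ?V K) = card (?V (I \<inter> K))"
    by (intro conjI; linarith)
  then show "tight t A (I \<union> K)" "tight t A (I \<inter> K)" by (simp_all only: tight_def Vun)
  show "?V (I \<inter> K) = ?V I \<inter> ?V K"
    using sub fin * by (intro card_subset_eq) auto
qed

definition separated :: "('i \<Rightarrow> 'a set) \<Rightarrow> 'i set \<Rightarrow> 'a \<Rightarrow> 'a set" where
  "separated A I x = {y \<in> \<Union>(A ` I). \<forall>i\<in>I. x \<in> A i \<longrightarrow> y \<notin> A i}"

text \<open>The elements \<open>y\<close> whose replacement by \<open>x\<close> would break the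
  union condition at a tight set within \<open>X\<close>: the union loses \<open>y\<close> and
  already contains \<open>x\<close>. The parameter \<open>X\<close> serves the induction over
  subsets.\<close>

definition linked :: "nat \<Rightarrow> ('i \<Rightarrow> 'a set) \<Rightarrow> 'i set \<Rightarrow> 'a \<Rightarrow> 'a set" where
  "linked t A X x = \<Union>{separated A I x | I. I \<subseteq> X \<and> tight t A I \<and> x \<in> \<Union>(A ` I)}"

lemma linked_iff:
  "y \<in> linked t A X x \<longleftrightarrow>
    (\<exists>I\<subseteq>X. tight t A I \<and> x \<in> \<Union>(A ` I) \<and> y \<in> separated A I x)"
  unfolding linked_def by blast

lemma linkedI:
  "I \<subseteq> X \<Longrightarrow> tight t A I \<Longrightarrow> x \<in> \<Union>(A ` I) \<Longrightarrow> y \<in> separated A I x \<Longrightarrow> y \<in> linked t A X x"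
  unfolding linked_def by blast

lemma linked_mono: "X \<subseteq> Y \<Longrightarrow> linked t A X x \<subseteq> linked t A Y x"
  unfolding linked_def by blast

lemma linked_subset_UN: "linked t A X x \<subseteq> \<Union>(A ` X)"
  unfolding linked_def separated_def by blast

text \<open>A tight \<open>I\<close> that meets \<open>K\<close> but leaves it has tight union with
  \<open>K\<close>, which is \<open>X\<close> by maximality. If \<open>K\<close> covers
  \<open>y\<close>, so does \<open>I \<inter> K\<close>, and \<open>y\<close> is linked inside
  \<open>K\<close>; otherwise no set of \<open>K\<close> contains \<open>y\<close>, which is thus
  separated in \<open>X\<close>.\<close>

lemma linked_decompose:
  assumes H: "hall_family t J A" and "finite J" "X \<subseteq> J" "K \<subset> X"
    and K: "tight t A K" "x \<in> \<Union>(A ` K)"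
    and max: "\<And>I. K \<subseteq> I \<Longrightarrow> I \<subset> X \<Longrightarrow> tight t A I \<Longrightarrow> x \<in> \<Union>(A ` I) \<Longrightarrow> I = K"
    and y: "y \<in> linked t A X x"
  shows "y \<in> linked t A K x \<or> y \<in> linked t A (X - K) x \<or>
    tight t A X \<and> x \<in> \<Union>(A ` X) \<and> y \<in> separated A X x"
proof -
  from y obtain I where I: "I \<subseteq> X" "tight t A I" "x \<in> \<Union>(A ` I)" "y \<in> separated A I x"
    unfolding linked_iff by blast
  consider "I \<inter> K = {}" | "I \<subseteq> K" | "I \<inter> K \<noteq> {}" "\<not> I \<subseteq> K" by blast
  then show ?thesis
  proof cases
    case 1
    then have "I \<subseteq> X - K" using I by blast
    then show ?thesis using I linkedI by metis
  next
    case 2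
    then show ?thesis using I linkedI by metis
  next
    case 3
    have IJ: "I \<subseteq> J" "K \<subseteq> J" using I assms by blast+
    note unint = tight_Un_Int[OF H \<open>finite J\<close> IJ 3(1) I(2) K(1)]
    have X: "I \<union> K = X"
    proof (rule ccontr)
      assume "I \<union> K \<noteq> X"
      then have "I \<union> K = K"
        using I \<open>K \<subset> X\<close> K unint(1) by (intro max) auto
      then show False using 3 by blast
    qed
    show ?thesis
    proof (cases "y \<in> \<Union>(A ` K)")
      case True
      then have "y \<in> \<Union>(A ` (I \<inter> K))"
        using I(4) unint(3) by (auto simp: separated_def)
      then have "y \<in> separated A (I \<inter> K) x" using I(4) by (auto simp: separated_def)
      moreover have "x \<in> \<Union>(A ` (I \<inter> K))" using unint(3) I K by blast
      ultimately have "y \<in> linked t A K x" using unint(2) by (intro linkedI) auto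
      then show ?thesis by blast
    next
      case False
      then have "y \<in> separated A (I \<union> K) x" using I(4) by (auto simp: separated_def)
      moreover have "x \<in> \<Union>(A ` (I \<union> K))" using K by blast
      ultimately show ?thesis using X unint(1) by metis
    qed
  qed
qed

text \<open>
  If \<open>X\<close> is not tight, the elements linked to \<open>x\<close> come from the disjoint maximal tight subsets of
  \<open>X\<close> whose sets cover \<open>x\<close>, and \<open>Y\<close> is the union of these subsets. The clause on \<open>separated A Y x\<close> is what lets the
  induction absorb them into a larger tight \<open>X\<close>, by applying the union condition to \<open>Y\<close>
  together with all \<open>i \<in> X\<close> such that \<open>x \<in> A i\<close>.
\<close>

lemma card_linked_le_witness:
  assumes H: "hall_family t J A" and fJ: "finite J" and "X \<subseteq> J"
  shows "\<exists>Y\<subseteq>X. card (linked t A X x) \<le> card {i\<in>Y. x \<notin> A i} \<and>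
    separated A Y x \<subseteq> linked t A X x"
  using \<open>X \<subseteq> J\<close>
proof (induction "card X" arbitrary: X rule: less_induct)
  case less
  let ?V = "\<lambda>I. \<Union>(A ` I)" and ?R = "\<lambda>I. {i\<in>I. x \<notin> A i}" and ?D = "\<lambda>I. {i\<in>I. x \<in> A i}"
  let ?T = "\<lambda>I. tight t A I \<and> x \<in> ?V I"
  have fX: "finite X" using less.prems fJ by (rule finite_subset)
  have finV: "finite (?V I)" if "I \<subseteq> X" for I
    using that less.prems hall_family_finite_UN[OF H fJ] by blast
  \<comment> \<open>\<open>b\<close> accounts for the tight proper subsets; tightness of
    \<open>X\<close> itself can add only \<open>separated A X x\<close>.\<close>
  have "\<exists>b Y. Y \<subseteq> X \<and> b \<subseteq> linked t A X x \<and> card b \<le> card (?R Y) \<and> separated A Y x \<subseteq> b \<and>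
      linked t A X x \<subseteq> b \<union> (if ?T X then separated A X x else {})"
  proof (cases "\<exists>K. K \<subset> X \<and> ?T K")
    case False
    then have "linked t A X x \<subseteq> (if ?T X then separated A X x else {})"
      unfolding linked_def by (auto simp: psubset_eq)
    then show ?thesis by (intro exI[of _ "{}"]) (simp add: separated_def)
  next
    case True
    have "finite {K. K \<subset> X \<and> ?T K}"
      by (rule finite_subset[of _ "Pow X"]) (use fX in auto)
    with True obtain K where K: "K \<subset> X" "?T K"
      and max: "\<And>I. I \<subset> X \<Longrightarrow> ?T I \<Longrightarrow> K \<subseteq> I \<Longrightarrow> I = K"
      using finite_has_maximal[of "{K. K \<subset> X \<and> ?T K}"]
      by (metis (mono_tags, lifting) empty_iff mem_Collect_eq)
    have "K \<noteq> {}" using K by auto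
    then have lt: "card K < card X" "card (X - K) < card X"
      using K fX by (auto intro!: psubset_card_mono)
    \<comment> \<open>From \<open>Z\<close> only the bound is kept: \<open>K\<close> is tight and
      covers \<open>x\<close>, so \<open>separated A K x\<close> already consists of linked elements
      and all of \<open>K\<close> can enter the witness.\<close>
    obtain Z where Z: "Z \<subseteq> K" "card (linked t A K x) \<le> card (?R Z)"
      using less.hyps[OF lt(1)] K less.prems by blast
    obtain Y where Y: "Y \<subseteq> X - K" "card (linked t A (X - K) x) \<le> card (?R Y)"
      "separated A Y x \<subseteq> linked t A (X - K) x"
      using less.hyps[OF lt(2)] less.prems by blast
    let ?b = "linked t A K x \<union> linked t A (X - K) x"
    have fin: "finite K" "finite Y" using K Y fX by (meson finite_subset finite_Diff psubset_imp_subset)+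
    have "card ?b \<le> card (linked t A K x) + card (linked t A (X - K) x)" by (rule card_Un_le)
    also have "\<dots> \<le> card (?R K) + card (?R Y)"
      using Z Y card_mono[of "?R K" "?R Z"] fin by fastforce
    also have "\<dots> = card (?R K \<union> ?R Y)"
      using Y fin by (intro card_Un_disjoint[symmetric]) auto
    also have "?R K \<union> ?R Y = ?R (K \<union> Y)" by blast
    finally have "card ?b \<le> card (?R (K \<union> Y))" .
    moreover have "separated A K x \<subseteq> linked t A K x" using K unfolding linked_def by blast
    then have "separated A (K \<union> Y) x \<subseteq> ?b"
      using Y(3) unfolding separated_def by blast
    moreover have "linked t A X x \<subseteq> ?b \<union> (if ?T X then separated A X x else {})"
    proof
      fix y assume "y \<in> linked t A X x"
      then have "y \<in> linked t A K x \<or> y \<in> linked t A (X - K) x \<or>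
          tight t A X \<and> x \<in> ?V X \<and> y \<in> separated A X x"
        using K max by (intro linked_decompose[OF H fJ less.prems K(1)]) metis+
      then show "y \<in> ?b \<union> (if ?T X then separated A X x else {})" by (elim disjE) (simp_all only: if_True if_False Un_iff simp_thms)
    qed
    moreover have "?b \<subseteq> linked t A X x"
      using K by (intro Un_least linked_mono) auto
    moreover have "K \<union> Y \<subseteq> X" using K Y by blast
    ultimately show ?thesis by blast
  qed
  then obtain b Y where Y: "Y \<subseteq> X" "b \<subseteq> linked t A X x" "card b \<le> card (?R Y)"
    "separated A Y x \<subseteq> b" "linked t A X x \<subseteq> b \<union> (if ?T X then separated A X x else {})"
    by blast
  show ?case
  proof (cases "?T X")
    case False
    then have "linked t A X x = b" using Y by auto
    then show ?thesis using Y by blast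
  next
    case True
    have finb: "finite b" using Y(2) linked_subset_UN finV by (meson finite_subset order_refl)
    have bV: "b \<subseteq> ?V X" using Y(2) linked_subset_UN[of t A X x] by blast
    have D: "?D X \<noteq> {}" using True by blast
    have sep: "separated A X x = ?V X - ?V (?D X)" unfolding separated_def by blast
    have finD: "finite (?V (?D X))" "finite (?V Y)" by (rule finV, use Y in blast)+
    \<comment> \<open>Elements of \<open>b\<close> outside \<open>?V (?D X)\<close> are separated in
      \<open>X\<close> anyway, so they are counted only once.\<close>
    have linked: "linked t A X x \<subseteq> (?V X - ?V (?D X)) \<union> (b \<inter> ?V (?D X))"
      using Y(5) True bV sep by auto
    have "card (linked t A X x) \<le> card (?V X - ?V (?D X)) + card (b \<inter> ?V (?D X))"
      by (rule order_trans[OF card_mono[OF _ linked] card_Un_le]) (use finV finb in auto)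
    moreover have "card (?V X - ?V (?D X)) = card X + t - card (?V (?D X))"
      using True finD by (subst card_Diff_subset) (auto simp: tight_def)
    moreover have "card (?V (?D X)) \<le> card X + t"
      using True finV by (metis (no_types, lifting) UN_mono card_mono mem_Collect_eq order_refl subsetI tight_def)
    moreover have "card (b \<inter> ?V (?D X)) + card (b - ?V (?D X)) = card b"
      using finb by (metis card_Int_Diff)
    moreover have "card (?V Y - ?V (?D X)) \<le> card (b - ?V (?D X))"
      using finb Y(1,4) by (intro card_mono) (auto simp: separated_def)
    moreover have "card (?D X) + card (?R Y) + t \<le> card (?V (?D X)) + card (?V Y - ?V (?D X))"
    proof -
      have "card (?D X) + card (?R Y) = card (?D X \<union> ?R Y)"
        using fX Y(1) by (intro card_Un_disjoint[symmetric]) (auto intro: finite_subset)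
      also have "?D X \<union> ?R Y = ?D X \<union> Y" using Y(1) by blast
      also have "card (?D X \<union> Y) + t \<le> card (?V (?D X \<union> Y))"
        using D Y(1) less.prems by (intro hall_familyD[OF H]) auto
      also have "?V (?D X \<union> Y) = ?V (?D X) \<union> (?V Y - ?V (?D X))" by blast
      also have "card \<dots> = card (?V (?D X)) + card (?V Y - ?V (?D X))"
        using finD by (intro card_Un_disjoint) auto
      finally show ?thesis by simp
    qed
    moreover have "card X = card (?D X) + card (?R X)"
    proof -
      have "X = ?D X \<union> ?R X" by blast
      then show ?thesis using fX card_Un_disjoint[of "?D X" "?R X"] by auto
    qed
    \<comment> \<open>The \<open>t\<close> from tightness of \<open>X\<close> cancels against the
      \<open>t\<close> in the union condition for \<open>?D X \<union> Y\<close>, and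
      \<open>card (?V Y - ?V (?D X))\<close> against the part of \<open>b\<close> not counted again;
      what is left is \<open>card X - card (?D X)\<close>.\<close>
    ultimately have "card (linked t A X x) \<le> card (?R X)"
      using Y(3) by linarith
    moreover have "separated A X x \<subseteq> linked t A X x"
      using True unfolding linked_def by blast
    ultimately show ?thesis by blast
  qed
qed

lemma card_linked_le:
  assumes "hall_family t J A" "finite J"
  shows "card (linked t A J x) \<le> card {i\<in>J. x \<notin> A i}"
proof -
  obtain Y where "Y \<subseteq> J" "card (linked t A J x) \<le> card {i\<in>Y. x \<notin> A i}"
    using card_linked_le_witness[OF assms order_refl] by blast
  moreover have "card {i\<in>Y. x \<notin> A i} \<le> card {i\<in>J. x \<notin> A i}"
    using \<open>Y \<subseteq> J\<close> assms(2) by (intro card_mono) auto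
  ultimately show ?thesis by simp
qed

text \<open>The sets avoiding \<open>x\<close> cover at least \<open>card ?R + t\<close> elements,
  while at most \<open>card ?R\<close> are linked to \<open>x\<close> and fewer than
  \<open>t\<close> lie in the core, so some covered \<open>y\<close> is neither.\<close>

lemma exists_unlinked_crossing_pair:
  assumes H: "hall_family t J A" and fJ: "finite J" and "J \<noteq> {}"
    and core: "card (\<Inter>(A ` J)) < t"
  obtains x y i j where "i \<in> J" "x \<in> A i" "y \<notin> A i" "j \<in> J" "y \<in> A j" "x \<notin> A j"
    "y \<notin> linked t A J x"
proof -
  let ?C = "\<Inter>(A ` J)" and ?V = "\<Union>(A ` J)" and ?deg = "\<lambda>x. card {i\<in>J. x \<in> A i}"
  have finV: "finite ?V" using hall_family_finite_UN[OF H fJ] by blast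
  have CV: "?C \<subseteq> ?V" using \<open>J \<noteq> {}\<close> by blast
  then have finC: "finite ?C" using finV by (rule finite_subset)
  have "card ?C < card ?V"
    using core hall_familyD[OF H order_refl \<open>J \<noteq> {}\<close>] by linarith
  then have "?V - ?C \<noteq> {}"
    using finC by (metis card_mono Diff_eq_empty_iff not_less)
  then have "Max (?deg ` (?V - ?C)) \<in> ?deg ` (?V - ?C)"
    using finV by (intro Max_in) auto
  then obtain x where x: "x \<in> ?V - ?C" and "?deg x = Max (?deg ` (?V - ?C))"
    by (metis (no_types, lifting) imageE)
  then have max: "?deg y \<le> ?deg x" if "y \<in> ?V - ?C" for y
    using finV that by (metis (no_types, lifting) Max_ge finite_Diff finite_imageI imageI)
  let ?R = "{j\<in>J. x \<notin> A j}"
  have "?R \<noteq> {}" using x by blast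
  then have "card ?R + t \<le> card (\<Union>(A ` ?R))" by (intro hall_familyD[OF H]) auto
  moreover have "card (linked t A J x \<union> ?C) \<le> card (linked t A J x) + card ?C"
    by (rule card_Un_le)
  moreover note card_linked_le[OF H fJ, of x] core
  ultimately have "card (linked t A J x \<union> ?C) < card (\<Union>(A ` ?R))" by linarith
  moreover have "finite (linked t A J x \<union> ?C)"
    using finC finV linked_subset_UN by (metis finite_UnI finite_subset)
  ultimately have "\<not> \<Union>(A ` ?R) \<subseteq> linked t A J x \<union> ?C" by (meson card_mono not_less)
  then obtain y j where j: "j \<in> J" "x \<notin> A j" "y \<in> A j" and y: "y \<notin> linked t A J x" "y \<notin> ?C"
    by blast
  \<comment> \<open>Otherwise \<open>A j\<close> would give \<open>y\<close> a larger degree than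
    \<open>x\<close>, against the choice of \<open>x\<close>.\<close>
  have "\<exists>i\<in>J. x \<in> A i \<and> y \<notin> A i"
  proof (rule ccontr)
    assume "\<not> ?thesis"
    then have "{i\<in>J. x \<in> A i} \<subset> {i\<in>J. y \<in> A i}" using j by blast
    then have "?deg x < ?deg y" using fJ by (intro psubset_card_mono) auto
    then show False using max[of y] j y by force
  qed
  then show thesis using that j y by blast
qed

section \<open>The shift (compression) replacing \<open>y\<close> by \<open>x\<close>\<close>

definition shift :: "'a \<Rightarrow> 'a \<Rightarrow> ('i \<Rightarrow> 'a set) \<Rightarrow> 'i \<Rightarrow> 'a set" where
  "shift x y A i = (if y \<in> A i \<and> x \<notin> A i then insert x (A i - {y}) else A i)"

text \<open>A union over \<open>I\<close> can lose only \<open>y\<close>. If \<open>x\<close> was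
  missing from it, the new \<open>x\<close> makes up for the loss; if not, \<open>y\<close> is
  separated from \<open>x\<close> in \<open>I\<close>, so \<open>I\<close> is not tight and has one
  element to spare.\<close>

lemma hall_family_shift:
  assumes H: "hall_family t J A" and fJ: "finite J" and "x \<noteq> y"
    and unlinked: "y \<notin> linked t A J x"
  shows "hall_family t J (shift x y A)"
  unfolding hall_family_def
proof (intro conjI ballI allI impI)
  fix i assume "i \<in> J" then show "finite (shift x y A i)"
    using H by (simp add: hall_family_def shift_def)
next
  fix I assume I: "I \<subseteq> J" "I \<noteq> {}"
  let ?V = "\<Union>(A ` I)" and ?W = "\<Union>(shift x y A ` I)"
  have finV: "finite ?V" using hall_family_finite_UN[OF H fJ I(1)] .
  have "?W \<subseteq> insert x ?V" by (auto simp: shift_def split: if_splits)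
  then have finW: "finite ?W" using finV by (simp add: finite_subset)
  have sub: "?V - {y} \<subseteq> ?W" by (auto simp: shift_def)
  note ge = hall_familyD[OF H I]
  consider "y \<notin> ?V" | "y \<in> ?W" | "y \<in> ?V" "y \<notin> ?W" "x \<notin> ?V" | "y \<in> ?V" "y \<notin> ?W" "x \<in> ?V" by blast
  then show "card I + t \<le> card ?W"
  proof cases
    case 1
    then have "?V \<subseteq> ?W" using sub by blast
    then show ?thesis by (intro order_trans[OF ge] card_mono finW)
  next
    case 2
    then have "?V \<subseteq> ?W" using sub by blast
    then show ?thesis by (intro order_trans[OF ge] card_mono finW)
  next
    case 3
    from 3(1) obtain i where i: "i \<in> I" "y \<in> A i" by blast
    with 3(3) have "x \<in> shift x y A i" by (auto simp: shift_def)
    with i(1) have "x \<in> ?W" by blast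
    then have "insert x (?V - {y}) \<subseteq> ?W" using sub by blast
    then have "card (insert x (?V - {y})) \<le> card ?W" by (rule card_mono[OF finW])
    moreover have "card (insert x (?V - {y})) = Suc (card (?V - {y}))"
      using 3(3) finV by (intro card_insert_disjoint) auto
    moreover have "Suc (card (?V - {y})) = card ?V"
      using finV 3(1) by (rule card_Suc_Diff1)
    ultimately show ?thesis using ge by simp
  next
    case 4
    have "y \<notin> A i" if "i \<in> I" "x \<in> A i" for i
    proof
      assume "y \<in> A i"
      then have "y \<in> shift x y A i" using that(2) by (simp add: shift_def)
      then show False using 4(2) that(1) by blast
    qed
    then have "y \<in> separated A I x" using 4(1) unfolding separated_def by blast
    then have "\<not> tight t A I" using unlinked 4(3) I(1) by (metis linkedI)
    then have "card I + t < card ?V" using ge by (simp add: tight_def)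
    moreover have "card ?V = Suc (card (?V - {y}))"
      using card_Suc_Diff1[OF finV 4(1)] by (rule sym)
    moreover have "card (?V - {y}) \<le> card ?W" using sub by (rule card_mono[OF finW])
    ultimately show ?thesis by linarith
  qed
qed

section \<open>Extending partial SDRs; strict decrease of the number of SDRs\<close>

text \<open>Reserving the values on \<open>S\<close> costs every other union at most
  \<open>card S \<le> t\<close> elements, so Hall's condition survives on \<open>J - S\<close>. The
  resulting SDRs witness strictness below.\<close>

lemma extend_partial_SDR:
  assumes H: "hall_family t J A" and fJ: "finite J" and SJ: "S \<subseteq> J" and "card S \<le> t"
    and inj: "inj_on f S" and mem: "\<And>i. i \<in> S \<Longrightarrow> f i \<in> A i"
  obtains g where "g \<in> PiE J A" "inj_on g J" "\<And>i. i \<in> S \<Longrightarrow> g i = f i"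
proof -
  have fS: "finite S" using SJ fJ by (rule finite_subset)
  have "card (f ` S) = card S" using inj by (rule card_image)
  then have "hall_family ((t - card S) + card (f ` S)) (J - S) A"
    using hall_family_subset[OF H Diff_subset] \<open>card S \<le> t\<close> by simp
  then have "hall_family (t - card S) (J - S) (\<lambda>i. A i - f ` S)"
    by (rule hall_family_Diff_weaken) (rule finite_imageI[OF fS])
  then have "hall_family 0 (J - S) (\<lambda>i. A i - f ` S)"
    by (rule hall_family_mono) simp
  then obtain h where h: "h \<in> PiE (J - S) (\<lambda>i. A i - f ` S)" "inj_on h (J - S)"
    using hall_marriage fJ by blast
  have hmem: "h i \<in> A i - f ` S" if "i \<in> J - S" for i using PiE_mem[OF h(1) that] .
  let ?g = "\<lambda>i. if i \<in> S then f i else h i"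
  show thesis
  proof (rule that[of ?g])
    show "?g \<in> PiE J A"
    proof (rule PiE_I)
      fix i assume "i \<in> J" then show "?g i \<in> A i"
        using mem[of i] hmem[of i] by simp
    next
      fix i assume "i \<notin> J" then show "?g i = undefined"
        using SJ PiE_arb[OF h(1), of i] by auto
    qed
    show "inj_on ?g J"
    proof (rule inj_onI)
      fix i k assume ik: "i \<in> J" "k \<in> J" "?g i = ?g k"
      consider "i \<in> S" "k \<in> S" | "i \<notin> S" "k \<notin> S" | "i \<in> S \<longleftrightarrow> k \<notin> S" by blast
      then show "i = k"
      proof cases
        case 1 then show ?thesis using ik(3) inj by (simp add: inj_on_eq_iff)
      next
        case 2 then show ?thesis using ik h(2) by (simp add: inj_on_eq_iff)
      next
        case 3
        then have "?g i \<in> f ` S \<longleftrightarrow> ?g k \<notin> f ` S"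
          using hmem[of i] hmem[of k] ik(1,2) by auto
        then show ?thesis using ik(3) by metis
      qed
    qed
  qed simp
qed

lemma finite_SDRs:
  assumes "\<And>i. i \<in> {1..n} \<Longrightarrow> finite (A i)"
  shows "finite (SDRs n A)"
proof (rule finite_subset)
  show "SDRs n A \<subseteq> PiE {1..n} A" by (auto simp: SDRs_def)
  show "finite (PiE {1..n} A)" using assms by (intro finite_PiE) auto
qed

lemma num_SDRs_cong:
  assumes "\<And>i. i \<in> {1..n} \<Longrightarrow> A i = B i"
  shows "num_SDRs n A = num_SDRs n B"
proof -
  have "PiE {1..n} A = PiE {1..n} B" using assms by (rule PiE_cong)
  then show ?thesis by (simp only: num_SDRs_def SDRs_def)
qed

lemma num_SDRs_remove_less:
  assumes H: "tn_family t n A" and "t \<ge> 1" and i: "i \<in> {1..n}" "y \<in> A i"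
  shows "num_SDRs n (A(i := A i - {y})) < num_SDRs n A"
proof -
  let ?B = "A(i := A i - {y})"
  obtain g where g: "g \<in> PiE {1..n} A" "inj_on g {1..n}" "g i = y"
    using extend_partial_SDR[of t "{1..n}" A "{i}" "\<lambda>_. y"] H i \<open>t \<ge> 1\<close>
    by (auto simp: tn_family_iff_hall_family)
  have "SDRs n ?B \<subseteq> SDRs n A"
    by (auto simp: SDRs_def PiE_iff split: if_splits)
  moreover have "g \<in> SDRs n A" using g by (simp add: SDRs_def)
  moreover have "g \<notin> SDRs n ?B"
    using g(3) i PiE_mem[of g "{1..n}" ?B i] by (auto simp: SDRs_def)
  ultimately show ?thesis
    unfolding num_SDRs_def using finite_SDRs[of n A] H by (intro psubset_card_mono) (auto simp: tn_family_def)
qed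

lemma shift_mem:
  assumes "x \<noteq> y"
  shows "a \<in> shift x y A i \<longleftrightarrow>
    (if a = x then x \<in> A i \<or> y \<in> A i else if a = y then x \<in> A i \<and> y \<in> A i else a \<in> A i)"
  using assms by (auto simp: shift_def)

lemma num_SDRs_shift_less:
  assumes H: "tn_family t n A" and "t \<ge> 2"
    and i: "i \<in> {1..n}" "x \<in> A i" "y \<notin> A i"
    and j: "j \<in> {1..n}" "y \<in> A j" "x \<notin> A j"
  shows "num_SDRs n (shift x y A) < num_SDRs n A"
proof -
  have xy: "x \<noteq> y" using i by blast
  let ?J = "{1..n}" and ?B = "shift x y A"
  \<comment> \<open>An SDR of the shifted family that is not one of \<open>A\<close> becomes one by exchanging the values
    \<open>x\<close> and \<open>y\<close>; no SDR with \<open>i \<mapsto> x\<close> and \<open>j \<mapsto> y\<close> arises in this way.\<close>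
  define swap where "swap = id(x := y, y := x)"
  have swap: "swap x = y" "swap y = x" "a \<noteq> x \<Longrightarrow> a \<noteq> y \<Longrightarrow> swap a = a" for a
    using xy by (auto simp: swap_def)
  have swap2: "swap (swap a) = a" for a using swap by metis
  define G where "G f = restrict (swap \<circ> f) ?J" for f :: "nat \<Rightarrow> 'a"
  define F where "F f = (if f \<in> SDRs n A then f else G f)" for f
  have G: "\<exists>k\<in>?J. f k = x \<and> y \<in> A k \<and> x \<notin> A k" "G f \<in> SDRs n A"
    if f: "f \<in> SDRs n ?B" "f \<notin> SDRs n A" for f
  proof -
    have fB: "f k \<in> ?B k" if "k \<in> ?J" for k using f(1) that by (auto simp: SDRs_def)
    have inj: "inj_on f ?J" and ext: "f \<in> extensional ?J"
      using f(1) by (auto simp: SDRs_def PiE_def)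
    then obtain k where k: "k \<in> ?J" "f k \<notin> A k"
      using f(2) by (auto simp: SDRs_def PiE_iff)
    then have fk: "f k = x \<and> y \<in> A k \<and> x \<notin> A k"
      using fB[OF k(1)] xy by (auto simp: shift_mem split: if_splits)
    then show "\<exists>k\<in>?J. f k = x \<and> y \<in> A k \<and> x \<notin> A k" using k by blast
    \<comment> \<open>By injectivity \<open>k\<close> is the only index with value \<open>x\<close>,
      and a set that keeps \<open>y\<close> under the shift also contains \<open>x\<close>.\<close>
    have "swap (f l) \<in> A l" if l: "l \<in> ?J" for l
    proof -
      consider "f l = x" | "f l = y" | "f l \<noteq> x" "f l \<noteq> y" by blast
      then show ?thesis
      proof cases
        case 1
        then have "l = k" using inj k l fk by (auto dest: inj_onD)
        then show ?thesis using fk 1 swap by simp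
      qed (use fB[OF l] xy swap in \<open>auto simp: shift_mem\<close>)
    qed
    moreover have "inj_on (G f) ?J"
      using inj swap2 unfolding G_def inj_on_def by (metis comp_apply restrict_apply')
    ultimately show "G f \<in> SDRs n A" by (simp add: SDRs_def G_def)
  qed
  \<comment> \<open>This separates the two branches of \<open>F\<close>: an exchanged SDR takes
    \<open>y\<close> at \<open>k\<close>, where the shifted set lacks \<open>y\<close>, so it is
    never an SDR that \<open>F\<close> leaves unchanged.\<close>
  have GB: "G f \<notin> SDRs n ?B" if "f k = x" "k \<in> ?J" "x \<notin> A k" for f k
  proof
    assume "G f \<in> SDRs n ?B"
    then have "G f k \<in> ?B k" using that(2) by (auto simp: SDRs_def)
    then show False using that swap xy by (simp add: G_def shift_mem)
  qed
  have GG: "f = G (G f)" if "f \<in> SDRs n ?B" for f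
  proof
    fix k show "f k = G (G f) k"
      using that swap2 by (cases "k \<in> ?J") (auto simp: G_def SDRs_def PiE_iff extensional_def)
  qed
  have "inj_on F (SDRs n ?B)"
  proof (rule inj_onI)
    fix f g assume fg: "f \<in> SDRs n ?B" "g \<in> SDRs n ?B" "F f = F g"
    then show "f = g"
      using G(1)[of f] G(1)[of g] GB[of f] GB[of g] GG[of f] GG[of g]
      unfolding F_def by (metis (full_types))
  qed
  moreover have "F ` SDRs n ?B \<subset> SDRs n A"
  proof
    show "F ` SDRs n ?B \<subseteq> SDRs n A" using G(2) by (auto simp: F_def)
    have ij: "i \<noteq> j" using i j by blast
    obtain g where g: "g \<in> PiE ?J A" "inj_on g ?J" "g i = x" "g j = y"
    proof (rule extend_partial_SDR[of t ?J A "{i, j}" "\<lambda>k. if k = i then x else y"])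
      show "hall_family t ?J A" using H by (simp add: tn_family_iff_hall_family)
      show "inj_on (\<lambda>k. if k = i then x else y) {i, j}" using xy by (auto simp: inj_on_def)
    qed (use i j ij \<open>t \<ge> 2\<close> in auto)
    have "g \<notin> F ` SDRs n ?B"
    proof
      assume "g \<in> F ` SDRs n ?B"
      then obtain f where f: "f \<in> SDRs n ?B" "g = F f" by blast
      have fB: "f k \<in> ?B k" if "k \<in> ?J" for k using f(1) that by (auto simp: SDRs_def)
      \<comment> \<open>\<open>f j = y\<close> if \<open>F\<close> fixes \<open>f\<close>, and
        \<open>f i = y\<close> if it exchanges; but neither shifted set contains
        \<open>y\<close>.\<close>
      have "f i = y \<or> f j = y"
        using f(2) g(3,4) i(1) j(1) swap(1) swap2
        unfolding F_def G_def by (metis comp_apply restrict_apply')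
      then show False
        using fB[OF i(1)] fB[OF j(1)] i j xy by (auto simp: shift_mem)
    qed
    moreover have "g \<in> SDRs n A" using g by (simp add: SDRs_def)
    ultimately show "F ` SDRs n ?B \<noteq> SDRs n A" by blast
  qed
  ultimately show ?thesis
    unfolding num_SDRs_def using finite_SDRs[of n A] H[unfolded tn_family_def]
    by (metis card_image psubset_card_mono)
qed

section \<open>Sunflowers and the descent step\<close>

text \<open>A core of \<open>t\<close> elements leaves one private element in each set, and the
  union condition on pairs of indices keeps these distinct.\<close>

lemma large_core_imp_sunflower:
  fixes A :: "nat \<Rightarrow> 'a set"
  assumes H: "tn_family t n A" and "n \<ge> 1"
    and size: "\<And>i. i \<in> {1..n} \<Longrightarrow> card (A i) = t + 1"
    and core: "t \<le> card (\<Inter>(A ` {1..n}))"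
  shows "\<exists>\<phi> :: 'a \<Rightarrow> nat. bij_betw \<phi> (\<Union>i\<in>{1..n}. A i) {1..n + t} \<and>
    (\<forall>i\<in>{1..n}. \<phi> ` A i = Fstar t n i)"
proof -
  let ?J = "{1..n}"
  have finA: "finite (A i)" if "i \<in> ?J" for i using H that by (simp add: tn_family_def)
  \<comment> \<open>A subset is chosen because for \<open>n = 1\<close> the intersection is
    \<open>A 1\<close> itself, with \<open>t + 1\<close> elements.\<close>
  obtain C where C: "C \<subseteq> \<Inter>(A ` ?J)" "card C = t" "finite C"
    using obtain_subset_with_card_n[OF core] by blast
  have "\<exists>a. A i - C = {a}" if "i \<in> ?J" for i
  proof -
    have "C \<subseteq> A i" using C that by blast
    then have "card (A i - C) = 1" using C size[OF that] by (simp add: card_Diff_subset)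
    then show ?thesis by (rule card_1_singletonE) blast
  qed
  then obtain p where p: "\<And>i. i \<in> ?J \<Longrightarrow> A i - C = {p i}" by metis
  have A: "A i = insert (p i) C" "p i \<notin> C" if "i \<in> ?J" for i
    using p[OF that] C(1) that by blast+
  have injp: "inj_on p ?J"
  proof (rule inj_onI, rule ccontr)
    fix i j assume ij: "i \<in> ?J" "j \<in> ?J" "p i = p j" "i \<noteq> j"
    have "card {i, j} + t \<le> card (\<Union>(A ` {i, j}))"
      using H ij by (intro hall_familyD[of t ?J]) (auto simp: tn_family_iff_hall_family)
    moreover have "\<Union>(A ` {i, j}) = A i" using A(1)[OF ij(1)] A(1)[OF ij(2)] ij(3) by simp
    ultimately show False using size[OF ij(1)] ij(4) by simp
  qed
  have V: "(\<Union>i\<in>?J. A i) = p ` ?J \<union> C" using A(1) \<open>n \<ge> 1\<close> by fastforce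
  obtain \<psi> where \<psi>: "bij_betw \<psi> C {n + 1..n + t}"
    using finite_same_card_bij[OF C(3), of "{n + 1..n + t}"] C(2) by auto
  define \<phi> where "\<phi> a = (if a \<in> C then \<psi> a else inv_into ?J p a)" for a
  have \<phi>p: "\<phi> (p i) = i" if "i \<in> ?J" for i
    using A(2)[OF that] injp that by (simp add: \<phi>_def)
  have \<phi>C: "bij_betw \<phi> C {n + 1..n + t}"
    using \<psi> by (subst bij_betw_cong[of C \<phi> \<psi>]) (auto simp: \<phi>_def)
  have "bij_betw \<phi> (p ` ?J) ?J"
    by (rule bij_betw_byWitness[where f' = p]) (auto simp: \<phi>p)
  then have "bij_betw \<phi> (p ` ?J \<union> C) (?J \<union> {n + 1..n + t})"
    using \<phi>C by (rule bij_betw_combine) auto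
  moreover have "?J \<union> {n + 1..n + t} = {1..n + t}" by auto
  moreover have "\<phi> ` A i = Fstar t n i" if "i \<in> ?J" for i
    using A(1)[OF that] \<phi>p[OF that] \<phi>C by (simp add: Fstar_def bij_betw_def)
  ultimately have "bij_betw \<phi> (\<Union>i\<in>?J. A i) {1..n + t} \<and> (\<forall>i\<in>?J. \<phi> ` A i = Fstar t n i)"
    unfolding V by (simp only: ball_simps) blast
  then show ?thesis by (rule exI[of _ \<phi>])
qed

lemma num_SDRs_sunflower:
  fixes A :: "nat \<Rightarrow> 'a set" and \<phi> :: "'a \<Rightarrow> nat"
  assumes "bij_betw \<phi> (\<Union>i\<in>{1..n}. A i) {1..n + t}"
    and "\<forall>i\<in>{1..n}. \<phi> ` A i = Fstar t n i"
  shows "num_SDRs n A = num_SDRs n (Fstar t n)"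
proof -
  have "num_SDRs n A = num_SDRs n (\<lambda>i. \<phi> ` A i)"
    using assms(1) by (intro num_SDRs_rename[symmetric]) (simp add: bij_betw_def)
  also have "\<dots> = num_SDRs n (Fstar t n)" using assms(2) by (intro num_SDRs_cong) auto
  finally show ?thesis .
qed

text \<open>As the minimum is attained, one strict improvement suffices and no termination argument
  arises: a deletion if some set is too large, else a shift.\<close>

lemma exists_fewer_SDRs:
  fixes A :: "nat \<Rightarrow> 'a set"
  assumes H: "tn_family t n A" and "t \<ge> 2" and "n \<ge> 1"
    and not_sunflower: "\<not> (\<exists>\<phi> :: 'a \<Rightarrow> nat. bij_betw \<phi> (\<Union>i\<in>{1..n}. A i) {1..n + t} \<and>
      (\<forall>i\<in>{1..n}. \<phi> ` A i = Fstar t n i))"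
  shows "\<exists>B :: nat \<Rightarrow> 'a set. tn_family t n B \<and> num_SDRs n B < num_SDRs n A"
proof (cases "\<forall>i\<in>{1..n}. card (A i) = t + 1")
  case False
  have hall: "hall_family t {1..n} A" using H by (simp add: tn_family_iff_hall_family)
  from False obtain i where i: "i \<in> {1..n}" "t + 2 \<le> card (A i)"
    using hall_family_card_mem[OF hall] by (metis add_2_eq_Suc' add.commute le_antisym not_less_eq_eq plus_1_eq_Suc)
  then have "\<not> card (A i) \<le> Suc 0" "finite (A i)" using hall by (auto simp: hall_family_def)
  then obtain y z where yz: "y \<in> A i" "z \<in> A i" "y \<noteq> z" by (metis card_le_Suc0_iff_eq)
  then obtain w where "w \<in> A i" "tn_family t n (A(i := A i - {w}))"
    using hall_family_remove[OF hall _ i(1) yz i(2)] by (auto simp: tn_family_iff_hall_family)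
  then show ?thesis using num_SDRs_remove_less[OF H _ i(1)] \<open>t \<ge> 2\<close> by auto
next
  case True
  then have core: "card (\<Inter>(A ` {1..n})) < t"
    using large_core_imp_sunflower[OF H \<open>n \<ge> 1\<close>] not_sunflower by (meson not_less)
  have hall: "hall_family t {1..n} A" using H by (simp add: tn_family_iff_hall_family)
  have ne: "{1..n} \<noteq> {}" using \<open>n \<ge> 1\<close> by simp
  obtain x y i j where ij: "i \<in> {1..n}" "x \<in> A i" "y \<notin> A i"
      "j \<in> {1..n}" "y \<in> A j" "x \<notin> A j" and unlinked: "y \<notin> linked t A {1..n} x"
    by (rule exists_unlinked_crossing_pair[OF hall finite_atLeastAtMost ne core])
  have "x \<noteq> y" using ij by blast
  then have "tn_family t n (shift x y A)"
    using hall_family_shift[OF hall _ _ unlinked] by (simp add: tn_family_iff_hall_family)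
  then show ?thesis using num_SDRs_shift_less[OF H \<open>t \<ge> 2\<close> ij] by blast
qed

section \<open>The number of SDRs of \<open>Fstar\<close>\<close>

lemma U_0_left: "U 0 m = 1"
  by (simp add: U_def)

lemma U_0_right: "U c 0 = 1"
  unfolding U_def by (subst sum.atLeast_Suc_atMost) (auto intro!: sum.neutral)

text \<open>\<open>U c m\<close> counts the matchings of the complete bipartite graph with sides
  \<open>c\<close> and \<open>m\<close>; a new vertex is unmatched or has one of
  \<open>Suc c\<close> partners. In the sums this is Pascal's rule and the absorption
  identity.\<close>

lemma U_Suc_Suc: "U (Suc c) (Suc m) = U (Suc c) m + Suc c * U c m"
proof -
  have "U (Suc c) (Suc m) =
      1 + (\<Sum>j=0..c. (Suc c choose Suc j) * (Suc m choose Suc j) * fact (Suc j))"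
    unfolding U_def by (subst sum.atLeast0_atMost_Suc_shift) simp
  also have "\<dots> = 1 + (\<Sum>j=0..c. (Suc c choose Suc j) * (m choose Suc j) * fact (Suc j))
      + (\<Sum>j=0..c. (Suc c choose Suc j) * (m choose j) * fact (Suc j))"
    by (simp add: algebra_simps sum.distrib del: fact_Suc binomial_Suc_Suc)
       (simp add: algebra_simps sum.distrib)
  also have "1 + (\<Sum>j=0..c. (Suc c choose Suc j) * (m choose Suc j) * fact (Suc j)) = U (Suc c) m"
    unfolding U_def by (subst sum.atLeast0_atMost_Suc_shift) simp
  also have "(\<Sum>j=0..c. (Suc c choose Suc j) * (m choose j) * fact (Suc j)) = Suc c * U c m"
    unfolding U_def sum_distrib_left
  proof (rule sum.cong)
    fix j
    have "(Suc c choose Suc j) * (m choose j) * fact (Suc j)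
        = (Suc j * (Suc c choose Suc j)) * ((m choose j) * fact j)"
      by (simp only: fact_Suc of_nat_id ac_simps)
    also have "\<dots> = Suc c * ((c choose j) * (m choose j) * fact j)"
      unfolding Suc_times_binomial by (simp only: ac_simps)
    finally show "(Suc c choose Suc j) * (m choose j) * fact (Suc j)
        = Suc c * ((c choose j) * (m choose j) * fact j)" .
  qed simp
  finally show ?thesis .
qed

text \<open>The SDRs are split by their value at \<open>Suc m\<close>. The core is an arbitrary set
  because removing the chosen value from an interval need not leave an interval.\<close>

lemma num_SDRs_insert_core:
  fixes C :: "nat set"
  assumes "finite C" "C \<inter> {1..m} = {}"
  shows "num_SDRs m (\<lambda>i. insert i C) = U (card C) m"
  using assms
proof (induction m arbitrary: C)
  case 0
  then show ?case by (simp add: num_SDRs_def SDRs_def U_0_right)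
next
  case (Suc m)
  let ?B = "\<lambda>C i. insert i C :: nat set"
  \<comment> \<open>For \<open>a = Suc m\<close> the set \<open>C - {a}\<close> is just
    \<open>C\<close>, so both kinds of value share one formula.\<close>
  let ?S = "SIGMA a : insert (Suc m) C. SDRs m (?B (C - {a}))"
  have Sm: "Suc m \<notin> C" using Suc.prems(2) by auto
  have J: "{1..Suc m} = insert (Suc m) {1..m}" by auto
  have mem: "f \<in> SDRs k (?B D) \<longleftrightarrow>
      (\<forall>i\<in>{1..k}. f i = i \<or> f i \<in> D) \<and> f \<in> extensional {1..k} \<and> inj_on f {1..k}" for f k D
    by (auto simp: SDRs_def PiE_iff)
  have "bij_betw (\<lambda>(a, g). g(Suc m := a)) ?S (SDRs (Suc m) (?B C))"
  \<comment> \<open>\<open>undefined\<close> is the default value that shorter sequences take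
    outside \<open>{1..m}\<close>.\<close>
  proof (rule bij_betw_byWitness[where f' = "\<lambda>f. (f (Suc m), f(Suc m := undefined))"])
    show "\<forall>z\<in>?S. (\<lambda>f. (f (Suc m), f(Suc m := undefined))) ((\<lambda>(a, g). g(Suc m := a)) z) = z"
      by (auto simp: mem extensional_def fun_eq_iff)
    show "\<forall>f\<in>SDRs (Suc m) (?B C).
        (\<lambda>(a, g). g(Suc m := a)) (f (Suc m), f(Suc m := undefined)) = f"
      by simp
    show "(\<lambda>(a, g). g(Suc m := a)) ` ?S \<subseteq> SDRs (Suc m) (?B C)"
    proof clarify
      fix a g assume a: "a \<in> insert (Suc m) C" and "g \<in> SDRs m (?B (C - {a}))"
      then have g: "\<forall>i\<in>{1..m}. g i = i \<or> g i \<in> C - {a}" "g \<in> extensional {1..m}"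
        "inj_on g {1..m}" unfolding mem by blast+
      have "a \<notin> {1..m}" using a Suc.prems(2) by auto
      then have "a \<noteq> g i" if "i \<in> {1..m}" for i
        using g(1) that by (metis DiffD2 singletonI)
      then have "a \<notin> g ` {1..m}" by blast
      then have "inj_on (g(Suc m := a)) {1..Suc m}"
        unfolding J inj_on_insert using g(3) by (auto intro: inj_on_fun_updI)
      moreover have "(g(Suc m := a)) i = i \<or> (g(Suc m := a)) i \<in> C" if "i \<in> {1..Suc m}" for i
      proof (cases "i = Suc m")
        case False
        then have "i \<in> {1..m}" using that by simp
        then show ?thesis using g(1) False by auto
      qed (use a in auto)
      moreover have "g(Suc m := a) \<in> extensional {1..Suc m}"
        using g(2) unfolding J by (simp add: extensional_def)
      ultimately show "g(Suc m := a) \<in> SDRs (Suc m) (?B C)"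
        unfolding mem by blast
    qed
    show "(\<lambda>f. (f (Suc m), f(Suc m := undefined))) ` SDRs (Suc m) (?B C) \<subseteq> ?S"
    proof clarify
      fix f assume "f \<in> SDRs (Suc m) (?B C)"
      then have f: "\<forall>i\<in>{1..Suc m}. f i = i \<or> f i \<in> C" "f \<in> extensional {1..Suc m}"
        "inj_on f {1..Suc m}" unfolding mem by blast+
      have ne: "f i \<noteq> f (Suc m)" if "i \<in> {1..m}" for i
        using f(3) that by (auto dest!: inj_onD)
      have "inj_on (f(Suc m := undefined)) {1..m}" using f(3) by (auto simp: inj_on_def)
      moreover have "f(Suc m := undefined) \<in> extensional {1..m}"
        using f(2) unfolding J extensional_def by simp
      moreover have "\<forall>i\<in>{1..m}. (f(Suc m := undefined)) i = i \<or>
          (f(Suc m := undefined)) i \<in> C - {f (Suc m)}"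
        using f(1) ne by simp
      ultimately have "f(Suc m := undefined) \<in> SDRs m (?B (C - {f (Suc m)}))"
        unfolding mem by blast
      then show "f (Suc m) \<in> insert (Suc m) C \<and>
          f(Suc m := undefined) \<in> SDRs m (?B (C - {f (Suc m)}))" using f(1) by auto
    qed
  qed
  then have "num_SDRs (Suc m) (?B C) = card ?S"
    unfolding num_SDRs_def by (rule bij_betw_same_card[symmetric])
  also have "\<dots> = (\<Sum>a\<in>insert (Suc m) C. num_SDRs m (?B (C - {a})))"
    unfolding num_SDRs_def
    using Suc.prems(1) by (intro card_SigmaI ballI finite_SDRs) auto
  also have "\<dots> = (\<Sum>a\<in>insert (Suc m) C. U (card (C - {a})) m)"
    using Suc.prems by (intro sum.cong refl Suc.IH) auto
  also have "\<dots> = U (card C) m + (\<Sum>a\<in>C. U (card C - 1) m)"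
    using Suc.prems(1) Sm by (simp add: card_Diff_singleton)
  also have "\<dots> = U (card C) (Suc m)"
  proof (cases "card C")
    case 0
    then show ?thesis by (simp add: U_0_left)
  next
    case (Suc c)
    then show ?thesis by (simp add: U_Suc_Suc)
  qed
  finally show ?case .
qed

lemma num_SDRs_Fstar: "num_SDRs n (Fstar t n) = U t n"
  using num_SDRs_insert_core[of "{n + 1..n + t}" n] by (simp add: Fstar_def[abs_def])

theorem mainTheorem2:
  fixes t n :: nat
  assumes "t \<ge> 3" and "n \<ge> 1"
  shows "min_SDRs t n = U t n \<and>
    tn_family t n (Fstar t n) \<and> num_SDRs n (Fstar t n) = min_SDRs t n \<and>
    (\<forall>A :: nat \<Rightarrow> 'a set. tn_family t n A \<longrightarrow>
      (num_SDRs n A = min_SDRs t n \<longleftrightarrow>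
        (\<exists>\<phi> :: 'a \<Rightarrow> nat. bij_betw \<phi> (\<Union>i\<in>{1..n}. A i) {1..n + t} \<and>
             (\<forall>i\<in>{1..n}. \<phi> ` A i = Fstar t n i))))"
proof -
  have t: "t \<ge> 2" using assms by simp
  \<comment> \<open>\<open>min_SDRs\<close> is defined by families over \<open>nat\<close>, so these
    come first: a minimiser admits no strict improvement, hence is a renaming of
    \<open>Fstar t n\<close>, which fixes the value.\<close>
  obtain M :: "nat \<Rightarrow> nat set" where M: "tn_family t n M" "num_SDRs n M = min_SDRs t n"
    using min_SDRs_attained by blast
  have "\<exists>\<phi> :: nat \<Rightarrow> nat. bij_betw \<phi> (\<Union>i\<in>{1..n}. M i) {1..n + t} \<and>
      (\<forall>i\<in>{1..n}. \<phi> ` M i = Fstar t n i)"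
    using exists_fewer_SDRs[OF M(1) t \<open>n \<ge> 1\<close>] M(2) by (metis min_SDRs_le not_less)
  then have min: "num_SDRs n (Fstar t n) = min_SDRs t n"
    using M(2) num_SDRs_sunflower by metis
  moreover have "num_SDRs n A = min_SDRs t n \<longleftrightarrow>
      (\<exists>\<phi> :: 'a \<Rightarrow> nat. bij_betw \<phi> (\<Union>i\<in>{1..n}. A i) {1..n + t} \<and>
        (\<forall>i\<in>{1..n}. \<phi> ` A i = Fstar t n i))" if A: "tn_family t n A" for A :: "nat \<Rightarrow> 'a set"
    using exists_fewer_SDRs[OF A t \<open>n \<ge> 1\<close>] num_SDRs_sunflower min
    by (metis min_SDRs_le not_less)
  ultimately show ?thesis
    using tn_family_Fstar num_SDRs_Fstar by metis
qed

end
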